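(* In the homogeneous gradation, for $m\ge0$ let $$L_m=l_m-\sum_{i=1}^{\infty}i\,t_i\,E^{(m+i)},\qquad l_m=-\lambda^{m+1}\frac{d}{d\lambda},\qquad L_m^{\Theta}=\Theta L_m\Theta^{-1},$$ and define the transformation $\delta_m^V$ by $\delta_m^V\Theta=(L_m^{\Theta})_-\,\Theta$. Then these transformations form the Borel subalgebra of the (centerless) Virasoro algebra: $$\big(\delta_m^V\delta_n^V-\delta_n^V\delta_m^V\big)\Theta=(m-n)\,\delta_{m+n}^V\Theta,\qquad m,n\ge0 .$$
   Context: Algebra. $\widehat{\mathcal G}$ is the (centerless) loop algebra of a matrix Lie algebra with loop parameter $\lambda$ and the homogeneous gradation: the grading operator is $d=\lambda\frac{d}{d\lambda}$, so grade $n$ means proportional to $\lambda^n$. Infinite sums over descending negative grades are allowed. $E=\lambda E^{(0)}$, with $E^{(0)}$ a constant semisimple element of the matrix Lie algebra, and $E^{(n)}=\lambda^nE^{(0)}$. $\mathcal K=\mathrm{Ker}(\mathrm{ad}\,E)$, $\mathcal M=\mathrm{Im}(\mathrm{ad}\,E)$, $\mathcal M_0$ is the grade-zero part of $\mathcal M$. Dressing. $L=D_x+E+A$, with $D_x$ differentiation $\partial_x$ and $A\in\mathcal M_0$; $\Theta=1+\sum_{k\ge1}\theta^{(-k)}\lambda^{-k}$ is a dressing operator, $\Theta^{-1}(D_x+E+A)\Theta=D_x+E$, depending on the isospectral times $t=(t_1=x,t_2,\dots)$ (the sum over $i$ is understood formally, or with only finitely many nonzero $t_i$). Projection. $L_m^\Theta$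 is a first-order differential operator in $\lambda$: $L_m^\Theta=l_m+\Theta\,[l_m,\Theta^{-1}]-\sum_i i\,t_i\,\Theta E^{(m+i)}\Theta^{-1}$, where $[l_m,\Theta^{-1}]=-\lambda^{m+1}\,d\Theta^{-1}/d\lambda$. $(\cdot)_-$ denotes the part of strictly negative grade, where $l_m$ itself counts as grade $m\ge0$; hence $(L_m^\Theta)_-$ is a matrix series in negative powers of $\lambda$. Each $\delta_m^V$ acts as a derivation (Leibniz rule) on expressions in $\Theta$, commutes with $d/d\lambda$, and vanishes on constant matrices, on $\lambda$ and on the explicit parameters $t_i$. *)

theory Defs
  imports "HOL-Analysis.Analysis" "HOL-Computational_Algebra.Computational_Algebra"
begin

notation fls_nth (infixl "$$" 75)

text \<open>
  Conventions. \<open>'k\<close> is the field of constants and \<open>'f\<close> a commutative ring of coefficients (the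
  expressions in the times \<open>t i\<close> and in the entries of the \<open>\<theta>\<close>'s), containing the constants via a
  ring homomorphism \<open>\<iota> :: 'k \<Rightarrow> 'f\<close>.  Series in descending powers of the loop parameter \<open>\<lambda>\<close> are
  formal Laurent series in \<open>1/\<lambda>\<close>, i.e. the indeterminate \<open>fls_X\<close> is \<open>1/\<lambda>\<close>: the
  coefficient of \<open>\<lambda>^n\<close> (grade \<open>n\<close>) in \<open>f\<close> is \<open>f $$ (-n)\<close>.
  The product of matrices is \<open>**\<close>, not the entrywise \<open>*\<close>.
\<close>

definition const_hom :: "('k::field \<Rightarrow> 'f::comm_ring_1) \<Rightarrow> bool" where
  "const_hom \<iota> \<longleftrightarrow>
     \<iota> 1 = 1 \<and> (\<forall>a b. \<iota> (a + b) = \<iota> a + \<iota> b) \<and> (\<forall>a b. \<iota> (a * b) = \<iota> a * \<iota> b)"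

definition derivation :: "('f::comm_ring_1 \<Rightarrow> 'f) \<Rightarrow> bool" where
  "derivation D \<longleftrightarrow>
     (\<forall>a b. D (a + b) = D a + D b) \<and> (\<forall>a b. D (a * b) = D a * b + a * D b)"

definition mscale :: "'r::times \<Rightarrow> 'r^'n^'n \<Rightarrow> 'r^'n^'n" where
  "mscale c = map_matrix ((*) c)"

definition bracket :: "'r::comm_ring_1^'n^'n \<Rightarrow> 'r^'n^'n \<Rightarrow> 'r^'n^'n" where
  "bracket X Y = X ** Y - Y ** X"

definition matrix_lie_algebra :: "('k::field^'n^'n) set \<Rightarrow> bool" where
  "matrix_lie_algebra \<gg> \<longleftrightarrow>
     module.subspace mscale \<gg> \<and> (\<forall>X\<in>\<gg>. \<forall>Y\<in>\<gg>. bracket X Y \<in> \<gg>)"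

text \<open>Over an algebraically closed field, \<open>ad H\<close> is semisimple on \<open>\<gg>\<close> iff its eigenvectors
  span \<open>\<gg>\<close>.\<close>

definition semisimple_element :: "('k::field^'n^'n) set \<Rightarrow> 'k^'n^'n \<Rightarrow> bool" where
  "semisimple_element \<gg> H \<longleftrightarrow>
     H \<in> \<gg> \<and> \<gg> \<subseteq> module.span mscale {X \<in> \<gg>. \<exists>c. bracket H X = mscale c X}"


subsection \<open>Series in \<open>\<lambda>\<close>\<close>

definition lam :: "'f::comm_ring_1 fls" where
  "lam = fls_X_inv"

text \<open>\<open>d/d\<lambda> = - z^2 d/dz\<close> for \<open>z = 1/\<lambda>\<close>.\<close>

definition ddlam :: "'f::comm_ring_1 fls \<Rightarrow> 'f fls" where
  "ddlam f = - (fls_X ^ 2 * fls_deriv f)"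

text \<open>Coefficientwise action of a map of \<open>'f\<close>; only meant for maps fixing \<open>0\<close>.  A derivation
  acting this way vanishes on \<open>\<lambda>\<close>, obeys the Leibniz rule and commutes with \<open>d/d\<lambda>\<close>, see
  \<open>coeffwise_lam\<close>, \<open>coeffwise_mult\<close> and \<open>coeffwise_ddlam\<close> below.\<close>

definition coeffwise :: "('f::comm_ring_1 \<Rightarrow> 'f) \<Rightarrow> 'f fls \<Rightarrow> 'f fls" where
  "coeffwise D f = Abs_fls (\<lambda>k. D (f $$ k))"

definition neg_grade :: "'f::comm_ring_1 fls \<Rightarrow> 'f fls" where
  "neg_grade f = Abs_fls (\<lambda>k. if k > 0 then f $$ k else 0)"

definition grade_part :: "int \<Rightarrow> 'f::comm_ring_1 fls^'n^'n \<Rightarrow> 'f^'n^'n" where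
  "grade_part n X = map_matrix (\<lambda>f. f $$ (- n)) X"

text \<open>\<open>E^(n) = \<lambda>^n E^(0)\<close>; in particular \<open>E\<close> is \<open>Egr \<iota> E0 1\<close>.\<close>

definition Egr :: "('k::field \<Rightarrow> 'f::comm_ring_1) \<Rightarrow> 'k^'n^'n \<Rightarrow> nat \<Rightarrow> 'f fls^'n^'n" where
  "Egr \<iota> E0 n = map_matrix (\<lambda>c. lam ^ n * fls_const (\<iota> c)) E0"


subsection \<open>The loop algebra and the space \<open>\<M>\<^sub>0\<close>\<close>

definition loop_algebra ::
    "('k::field \<Rightarrow> 'f::comm_ring_1) \<Rightarrow> ('k^'n^'n) set \<Rightarrow> ('f fls^'n^'n) set" where
  "loop_algebra \<iota> \<gg> = {X. \<forall>n. grade_part n X \<in> module.span mscale (map_matrix \<iota> ` \<gg>)}"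

definition im_ad ::
    "('k::field \<Rightarrow> 'f::comm_ring_1) \<Rightarrow> ('k^'n^'n) set \<Rightarrow> 'k^'n^'n \<Rightarrow> ('f fls^'n^'n) set" where
  "im_ad \<iota> \<gg> E0 = bracket (Egr \<iota> E0 1) ` loop_algebra \<iota> \<gg>"

definition im_ad_zero ::
    "('k::field \<Rightarrow> 'f::comm_ring_1) \<Rightarrow> ('k^'n^'n) set \<Rightarrow> 'k^'n^'n \<Rightarrow> ('f fls^'n^'n) set" where
  "im_ad_zero \<iota> \<gg> E0 = {X \<in> im_ad \<iota> \<gg> E0. \<forall>n. n \<noteq> 0 \<longrightarrow> grade_part n X = 0}"


subsection \<open>Dressing\<close>

text \<open>Operators act on column vectors of series; \<open>Dx\<close> is \<open>\<partial>\<^sub>x\<close> on the coefficients.\<close>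

definition lax_op ::
    "('f::comm_ring_1 \<Rightarrow> 'f) \<Rightarrow> 'f fls^'n^'n \<Rightarrow> 'f fls^'n \<Rightarrow> 'f fls^'n" where
  "lax_op Dx B \<psi> = (\<chi> i. coeffwise Dx (\<psi> $ i)) + B *v \<psi>"

text \<open>\<open>1 + \<Sum>k\<ge>1. \<theta>^(-k) \<lambda>^(-k)\<close>\<close>

definition dressing_series :: "'f::comm_ring_1 fls^'n^'n \<Rightarrow> bool" where
  "dressing_series \<Theta> \<longleftrightarrow> grade_part 0 \<Theta> = mat 1 \<and> (\<forall>n>0. grade_part n \<Theta> = 0)"

definition conj_op ::
    "'f::comm_ring_1 fls^'n^'n \<Rightarrow> ('f fls^'n \<Rightarrow> 'f fls^'n) \<Rightarrow> 'f fls^'n \<Rightarrow> 'f fls^'n" where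
  "conj_op \<Theta> P = (*v) \<Theta> \<circ> P \<circ> (*v) (matrix_inv \<Theta>)"


subsection \<open>The Virasoro operators and their flows\<close>

definition l_op :: "nat \<Rightarrow> 'f::comm_ring_1 fls^'n \<Rightarrow> 'f fls^'n" where
  "l_op m \<psi> = (\<chi> i. - (lam ^ (m + 1) * ddlam (\<psi> $ i)))"

text \<open>The sum over the times, for finitely many nonzero times.\<close>

definition time_sum ::
    "('k::field \<Rightarrow> 'f::comm_ring_1) \<Rightarrow> 'k^'n^'n \<Rightarrow> (nat \<Rightarrow> 'f) \<Rightarrow> nat \<Rightarrow> 'f fls^'n^'n" where
  "time_sum \<iota> E0 t m =
     (\<Sum>i | i \<ge> 1 \<and> t i \<noteq> 0. mscale (of_nat i * fls_const (t i)) (Egr \<iota> E0 (m + i)))"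

definition L_op ::
    "('k::field \<Rightarrow> 'f::comm_ring_1) \<Rightarrow> 'k^'n^'n \<Rightarrow> (nat \<Rightarrow> 'f) \<Rightarrow> nat
      \<Rightarrow> 'f fls^'n \<Rightarrow> 'f fls^'n" where
  "L_op \<iota> E0 t m \<psi> = l_op m \<psi> - time_sum \<iota> E0 t m *v \<psi>"

text \<open>For an operator \<open>P = l_m + B\<close> with \<open>B\<close> a matrix series, the part of strictly
  negative grade is that of \<open>B\<close>, as \<open>l_m\<close> has grade \<open>m \<ge> 0\<close>.  For \<open>P = \<Theta> L_m \<Theta>^(-1)\<close>
  the matrix \<open>B\<close> is given by \<open>conj_L_op\<close> below.\<close>

definition minus_part :: "nat \<Rightarrow> ('f::comm_ring_1 fls^'n \<Rightarrow> 'f fls^'n) \<Rightarrow> 'f fls^'n^'n" where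
  "minus_part m P = map_matrix neg_grade (matrix (\<lambda>\<psi>. P \<psi> - l_op m \<psi>))"

definition vir_flow ::
    "('k::field \<Rightarrow> 'f::comm_ring_1) \<Rightarrow> 'k^'n^'n \<Rightarrow> (nat \<Rightarrow> 'f) \<Rightarrow> 'f fls^'n^'n \<Rightarrow> nat
      \<Rightarrow> 'f fls^'n^'n" where
  "vir_flow \<iota> E0 t \<Theta> m = minus_part m (conj_op \<Theta> (L_op \<iota> E0 t m)) ** \<Theta>"


subsection \<open>Consistency of the conventions\<close>

lemma derivation_0: "derivation D \<Longrightarrow> D 0 = 0"
  unfolding derivation_def by (metis add_cancel_left_left add.right_neutral)

lemma derivation_1: "derivation D \<Longrightarrow> D 1 = 0"
  unfolding derivation_def by (metis add_cancel_left_left mult_1 mult.right_neutral)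

lemma derivation_add: "derivation D \<Longrightarrow> D (a + b) = D a + D b"
  unfolding derivation_def by blast

lemma derivation_mult: "derivation D \<Longrightarrow> D (a * b) = D a * b + a * D b"
  unfolding derivation_def by blast

lemma derivation_minus: "derivation D \<Longrightarrow> D (- a) = - D a"
  by (metis add.right_inverse derivation_0 derivation_add minus_unique)

lemma derivation_sum: "derivation D \<Longrightarrow> D (sum f S) = (\<Sum>i\<in>S. D (f i))"
  by (induction S rule: infinite_finite_induct) (auto simp: derivation_0 derivation_add)

lemma derivation_of_int: "derivation D \<Longrightarrow> D (of_int n) = 0"
proof (induction n rule: int_induct[where k = 0])
  case (step2 i)
  then show ?case by (metis add.right_neutral derivation_1 derivation_add derivation_minus
      minus_zero of_int_1 of_int_diff diff_conv_add_uminus)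
qed (auto simp: derivation_0 derivation_1 derivation_add)

lemma coeffwise_nth: "derivation D \<Longrightarrow> coeffwise D f $$ k = D (f $$ k)"
  unfolding coeffwise_def
  by (rule nth_Abs_fls_lower_bound[where N = "fls_subdegree f"]) (auto simp: derivation_0)

lemma coeffwise_lam: "derivation D \<Longrightarrow> coeffwise D lam = 0"
  by (intro fls_eqI) (simp add: coeffwise_nth derivation_0 derivation_1 lam_def)

lemma fls_times_nth_bounds:
  fixes f g :: "'a::comm_ring_1 fls"
  assumes "\<And>k. k < N \<Longrightarrow> f $$ k = 0" "\<And>k. k < M \<Longrightarrow> g $$ k = 0"
  shows "(f * g) $$ n = (\<Sum>i=N..n-M. f $$ i * g $$ (n - i))"
proof -
  have "(f * g) $$ n = (\<Sum>i=fls_subdegree f..n - fls_subdegree g. f $$ i * g $$ (n - i))"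
    by (rule fls_times_nth)
  also have "\<dots> = (\<Sum>i=N..n-M. f $$ i * g $$ (n - i))"
  proof (rule sum.mono_neutral_cong)
    fix i assume i: "i \<in> {N..n-M} - {fls_subdegree f..n - fls_subdegree g}"
    then have "i < fls_subdegree f \<or> n - i < fls_subdegree g" by auto
    then show "f $$ i * g $$ (n - i) = 0" by auto
  next
    fix i assume i: "i \<in> {fls_subdegree f..n - fls_subdegree g} - {N..n-M}"
    then have "i < N \<or> n - i < M" by auto
    then show "f $$ i * g $$ (n - i) = 0" using assms by auto
  qed auto
  finally show ?thesis .
qed

lemma coeffwise_mult:
  assumes D: "derivation D"
  shows "coeffwise D (f * g) = coeffwise D f * g + f * coeffwise D g"
proof (rule fls_eqI)
  fix n
  let ?N = "fls_subdegree f" and ?M = "fls_subdegree g"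
  note nth = coeffwise_nth[OF D]
  have 1: "(f * g) $$ n = (\<Sum>i=?N..n-?M. f $$ i * g $$ (n - i))"
    by (rule fls_times_nth_bounds) auto
  have 2: "(coeffwise D f * g) $$ n = (\<Sum>i=?N..n-?M. D (f $$ i) * g $$ (n - i))"
    by (subst fls_times_nth_bounds[where N = ?N and M = ?M])
      (auto simp: nth derivation_0[OF D])
  have 3: "(f * coeffwise D g) $$ n = (\<Sum>i=?N..n-?M. f $$ i * D (g $$ (n - i)))"
    by (subst fls_times_nth_bounds[where N = ?N and M = ?M])
      (auto simp: nth derivation_0[OF D])
  show "coeffwise D (f * g) $$ n = (coeffwise D f * g + f * coeffwise D g) $$ n"
    by (simp add: 1 2 3 nth derivation_sum[OF D] derivation_mult[OF D] sum.distrib)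
qed

lemma ddlam_nth: "ddlam f $$ n = - (of_int (n - 1) * f $$ (n - 1))"
  by (simp add: ddlam_def fls_X_power_times_conv_shift)

lemma coeffwise_ddlam:
  assumes D: "derivation D"
  shows "coeffwise D (ddlam f) = ddlam (coeffwise D f)"
  by (intro fls_eqI)
    (simp add: ddlam_nth coeffwise_nth[OF D] derivation_minus[OF D]
      derivation_mult[OF D] derivation_of_int[OF D] del: of_int_diff)

lemma ddlam_lam: "ddlam lam = 1"
  by (intro fls_eqI) (auto simp: ddlam_nth lam_def)

lemma ddlam_mult: "ddlam (f * g) = ddlam f * g + f * ddlam g"
  by (simp add: ddlam_def algebra_simps)

lemma ddlam_sum: "ddlam (sum f S) = (\<Sum>i\<in>S. ddlam (f i))"
  by (induction S rule: infinite_finite_induct) (auto simp: ddlam_def algebra_simps)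

text \<open>\<open>\<Theta> L_m \<Theta>^(-1) = l_m + \<Theta> [l_m, \<Theta>^(-1)] - \<Sum>i. i t_i \<Theta> E^(m+i) \<Theta>^(-1)\<close>\<close>

lemma conj_L_op:
  assumes "\<Theta> ** matrix_inv \<Theta> = mat 1"
  shows "conj_op \<Theta> (L_op \<iota> E0 t m) \<psi> =
    l_op m \<psi> + (\<Theta> ** map_matrix (\<lambda>f. - (lam ^ (m + 1) * ddlam f)) (matrix_inv \<Theta>)
                 - \<Theta> ** time_sum \<iota> E0 t m ** matrix_inv \<Theta>) *v \<psi>"
proof -
  let ?T = "matrix_inv \<Theta>"
  let ?B = "map_matrix (\<lambda>f. - (lam ^ (m + 1) * ddlam f)) ?T"
  have "l_op m (?T *v \<psi>) = ?B *v \<psi> + ?T *v l_op m \<psi>"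
    by (simp add: vec_eq_iff l_op_def matrix_vector_mult_def ddlam_sum ddlam_mult
        sum_distrib_left sum_negf[symmetric] sum.distrib[symmetric] algebra_simps)
  then have "\<Theta> *v l_op m (?T *v \<psi>) = (\<Theta> ** ?B) *v \<psi> + l_op m \<psi>"
    by (simp add: matrix_vector_right_distrib matrix_vector_mul_assoc assms)
  then show ?thesis
    by (simp add: conj_op_def L_op_def matrix_vector_mult_diff_distrib
        matrix_vector_mult_diff_rdistrib matrix_vector_mul_assoc matrix_mul_assoc)
qed

end

(* Write \<Theta> L_m \<Theta>^-1 = l_m + M_m with M_m a matrix series, and M_m = N_m + P_m with N_m of negative
   and P_m of nonnegative grade.  Conjugating [L_m, L_n] = (m - n) L_{m+n} gives the zero curvature
   equation l_m(M_n) - l_n(M_m) + [M_m, M_n] = (m - n) M_{m+n}.  As \<delta>_m \<Theta> = N_m \<Theta>, the commutator of the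
   flows on \<Theta> is (\<delta>_m N_n - \<delta>_n N_m - [N_m, N_n]) \<Theta>, and \<delta>_m M_n = [N_m, M_n] - l_n(N_m).  The bracket
   so obtained differs from the negative part of the left side of the zero curvature equation only
   by the negative part of l_m(P_n) - l_n(P_m) + [P_m, P_n], which vanishes because m, n \<ge> 0. *)
theory Submission
  imports Defs
begin

section \<open>Entrywise access to matrices and elementary facts about derivations\<close>

lemma map_matrix_nth [simp]: "map_matrix f X $ i $ j = f (X $ i $ j)"
  by (simp add: map_matrix_def)

lemma mscale_nth [simp]: "mscale c X $ i $ j = c * X $ i $ j"
  by (simp add: mscale_def)

lemma derivation_diff: "derivation D \<Longrightarrow> D (a - b) = D a - D b"
  using derivation_add[of D a "- b"] by (simp add: derivation_minus)

lemma derivation_power_eq_0: "derivation D \<Longrightarrow> D a = 0 \<Longrightarrow> D (a ^ n) = 0"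
  by (induction n) (simp_all add: derivation_1 derivation_mult)

lemma derivation_of_nat: "derivation D \<Longrightarrow> D (of_nat n) = 0"
  using derivation_of_int[of D "int n"] by simp


subsection \<open>Derivations on square matrices\<close>

lemma matrix_diff_ldistrib: "A ** (B - C) = A ** B - A ** (C :: 'a::comm_ring_1^'n^'n)"
  by (simp add: vec_eq_iff matrix_matrix_mult_def algebra_simps sum_subtractf)

lemma matrix_diff_rdistrib: "(B - C) ** A = B ** A - C ** (A :: 'a::comm_ring_1^'n^'n)"
  by (simp add: vec_eq_iff matrix_matrix_mult_def algebra_simps sum_subtractf)

lemma matrix_add_rdistrib': "(B + C) ** A = B ** A + C ** (A :: 'a::comm_ring_1^'n^'n)"
  by (simp add: vec_eq_iff matrix_matrix_mult_def algebra_simps sum.distrib)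

lemma matrix_zero_left: "0 ** A = (0 :: 'a::comm_ring_1^'n^'n)"
  by (simp add: vec_eq_iff matrix_matrix_mult_def)

lemma matrix_zero_right: "A ** 0 = (0 :: 'a::comm_ring_1^'n^'n)"
  by (simp add: vec_eq_iff matrix_matrix_mult_def)

lemma matrix_minus_left: "(- B) ** A = - (B ** (A :: 'a::comm_ring_1^'n^'n))"
  by (simp add: vec_eq_iff matrix_matrix_mult_def sum_negf)

lemma matrix_minus_right: "B ** (- A) = - (B ** (A :: 'a::comm_ring_1^'n^'n))"
  by (simp add: vec_eq_iff matrix_matrix_mult_def sum_negf)

lemma mscale_matrix_mult_left: "mscale c A ** B = mscale c (A ** (B :: 'a::comm_ring_1^'n^'n))"
  by (simp add: vec_eq_iff matrix_matrix_mult_def sum_distrib_left mult_ac)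

lemma mscale_matrix_mult_right: "A ** mscale c B = mscale c (A ** (B :: 'a::comm_ring_1^'n^'n))"
  by (simp add: vec_eq_iff matrix_matrix_mult_def sum_distrib_left mult_ac)

lemma mscale_diff: "mscale c (A - B) = mscale c A - mscale c (B :: 'a::comm_ring_1^'n^'n)"
  by (simp add: vec_eq_iff algebra_simps)

text \<open>Products are nested to the right, so cancellation facts used alongside this set carry a
  trailing factor.\<close>

lemmas matrix_ring_simps =
  matrix_diff_ldistrib matrix_diff_rdistrib matrix_add_ldistrib matrix_add_rdistrib'
  matrix_zero_left matrix_zero_right matrix_minus_left matrix_minus_right matrix_mul_assoc[symmetric]

lemma map_matrix_derivation_mult:
  "derivation D \<Longrightarrow> map_matrix D (X ** Y) = map_matrix D X ** Y + X ** map_matrix D Y"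
  by (simp add: vec_eq_iff matrix_matrix_mult_def derivation_sum derivation_mult sum.distrib)

lemma map_matrix_derivation_add:
  "derivation D \<Longrightarrow> map_matrix D (X + Y) = map_matrix D X + map_matrix D Y"
  by (simp add: vec_eq_iff derivation_add)

lemma map_matrix_derivation_diff:
  "derivation D \<Longrightarrow> map_matrix D (X - Y) = map_matrix D X - map_matrix D Y"
  by (simp add: vec_eq_iff derivation_diff)

lemma map_matrix_derivation_minus:
  "derivation D \<Longrightarrow> map_matrix D (- X) = - map_matrix D X"
  by (simp add: vec_eq_iff derivation_minus)

text \<open>Differentiate \<open>T ** \<Theta> = mat 1\<close> and multiply by \<open>T\<close> on
  the right.\<close>

lemma map_matrix_derivation_inverse:
  fixes T \<Theta> :: "'a::comm_ring_1^'n^'n"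
  assumes D: "derivation D" and 1: "T ** \<Theta> = mat 1" "\<Theta> ** T = mat 1"
  shows "map_matrix D T = - (T ** map_matrix D \<Theta> ** T)"
proof -
  have "map_matrix D (mat 1 :: 'a^'n^'n) = 0"
    by (simp add: vec_eq_iff mat_def derivation_0[OF D] derivation_1[OF D])
  then have "(map_matrix D T ** \<Theta> + T ** map_matrix D \<Theta>) ** T = 0"
    by (simp flip: map_matrix_derivation_mult[OF D] add: 1 matrix_zero_left)
  then show ?thesis
    by (simp add: matrix_ring_simps 1 eq_neg_iff_add_eq_0)
qed


subsection \<open>The vector fields \<open>l_m\<close> on series\<close>

text \<open>The vector field of \<open>l_op\<close> on a single series. As a derivation of the ring
  of series, it shares the matrix lemmas with the flows \<open>coeffwise D\<close>.\<close>

definition l_der :: "nat \<Rightarrow> 'f::comm_ring_1 fls \<Rightarrow> 'f fls" where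
  "l_der m f = - (lam ^ (m + 1) * ddlam f)"

lemma lam_power_mult_nth: "(lam ^ p * f) $$ k = f $$ (k + int p)"
  by (simp add: lam_def fls_X_inv_power_times_conv_shift)

lemma l_der_nth: "l_der m f $$ k = of_int (k + int m) * f $$ (k + int m)"
  by (simp only: l_der_def fls_uminus_nth lam_power_mult_nth ddlam_nth) (simp add: algebra_simps)

lemma derivation_l_der: "derivation (l_der m)"
  unfolding derivation_def
proof (intro conjI allI)
  show "l_der m (f + g) = l_der m f + l_der m g" for f g :: "'a fls"
    by (intro fls_eqI) (simp add: l_der_nth algebra_simps)
  show "l_der m (f * g) = l_der m f * g + f * l_der m g" for f g :: "'a fls"
    by (simp add: l_der_def ddlam_mult algebra_simps)
qed

lemma derivation_coeffwise: "derivation D \<Longrightarrow> derivation (coeffwise D)"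
  unfolding derivation_def[of "coeffwise D"]
  by (auto intro!: fls_eqI simp: coeffwise_nth derivation_add coeffwise_mult)

lemma coeffwise_l_der: "derivation D \<Longrightarrow> coeffwise D (l_der m f) = l_der m (coeffwise D f)"
  by (intro fls_eqI)
    (simp add: l_der_nth coeffwise_nth derivation_mult derivation_of_int del: of_int_add)

lemma coeffwise_fls_const: "derivation D \<Longrightarrow> coeffwise D (fls_const c) = fls_const (D c)"
  by (intro fls_eqI) (simp add: coeffwise_nth derivation_0)

text \<open>At index \<open>k\<close> both compositions read the coefficient at
  \<open>k + m + n\<close>, with factors \<open>(k + m) * (k + m + n)\<close> and
  \<open>(k + n) * (k + m + n)\<close>.\<close>

lemma l_der_commutator:
  "l_der m (l_der n f) - l_der n (l_der m f) = of_int (int m - int n) * l_der (m + n) f"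
proof (rule fls_eqI)
  fix k
  have *: "(of_int c * g) $$ k = of_int c * g $$ k" for c and g :: "'a fls"
    by (simp flip: fls_of_int)
  show "(l_der m (l_der n f) - l_der n (l_der m f)) $$ k =
      (of_int (int m - int n) * l_der (m + n) f) $$ k"
    by (simp only: fls_minus_nth * l_der_nth) (simp add: algebra_simps)
qed

lemma l_der_shift: "l_der m f = lam ^ m * l_der 0 f"
  by (simp add: l_der_def mult_ac)

lemma l_der_lam_power: "l_der m (lam ^ n) = - (of_nat n * lam ^ (m + n))"
proof (induction n)
  case (Suc n)
  have *: "l_der m (lam ^ Suc n) = - (lam ^ (m + 1)) * lam ^ n + lam * l_der m (lam ^ n)"
    by (simp add: derivation_mult[OF derivation_l_der]) (simp add: l_der_def ddlam_lam)
  show ?case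
    unfolding * Suc by (simp add: algebra_simps power_add)
qed (simp add: derivation_1[OF derivation_l_der])


subsection \<open>Projection to negative grades\<close>

lemma neg_grade_nth: "neg_grade f $$ k = (if k > 0 then f $$ k else 0)"
  unfolding neg_grade_def
  by (rule nth_Abs_fls_lower_bound[where N = 0]) auto

lemma neg_grade_0 [simp]: "neg_grade 0 = 0"
  by (intro fls_eqI) (simp add: neg_grade_nth)

lemma neg_grade_add: "neg_grade (f + g) = neg_grade f + neg_grade g"
  by (intro fls_eqI) (simp add: neg_grade_nth)

lemma neg_grade_diff: "neg_grade (f - g) = neg_grade f - neg_grade g"
  by (intro fls_eqI) (simp add: neg_grade_nth)

lemma neg_grade_sum: "neg_grade (sum f S) = (\<Sum>i\<in>S. neg_grade (f i))"
  by (induction S rule: infinite_finite_induct) (auto simp: neg_grade_add)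

lemma neg_grade_of_int_mult: "neg_grade (of_int c * f) = of_int c * neg_grade f"
  by (intro fls_eqI) (simp add: neg_grade_nth flip: fls_of_int)

lemma neg_grade_coeffwise:
  "derivation D \<Longrightarrow> neg_grade (coeffwise D f) = coeffwise D (neg_grade f)"
  by (intro fls_eqI) (simp add: neg_grade_nth coeffwise_nth derivation_0)

lemma neg_grade_idem [simp]: "neg_grade (neg_grade f) = neg_grade f"
  by (intro fls_eqI) (simp add: neg_grade_nth)

lemma neg_grade_eq_0_iff: "neg_grade f = 0 \<longleftrightarrow> (\<forall>k>0. f $$ k = 0)"
  by (auto simp: fls_eq_iff neg_grade_nth)

text \<open>\<open>l_der m\<close> raises the grade by \<open>m\<close>, and
  \<open>m \<ge> 0\<close> keeps nonnegative grades nonnegative.\<close>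

lemma neg_grade_l_der_eq_0: "neg_grade f = 0 \<Longrightarrow> neg_grade (l_der m f) = 0"
  by (simp add: neg_grade_eq_0_iff l_der_nth)

lemma neg_grade_mult_eq_0:
  assumes "neg_grade f = 0" "neg_grade g = 0"
  shows "neg_grade (f * g) = 0"
  unfolding neg_grade_eq_0_iff
proof (intro allI impI)
  fix k :: int assume "k > 0"
  \<comment> \<open>If \<open>i \<le> 0\<close> then \<open>k - i > 0\<close>, so one factor always
    has negative grade.\<close>
  then have "f $$ i * g $$ (k - i) = 0" for i
    using assms by (cases "i > 0") (auto simp: neg_grade_eq_0_iff)
  then show "(f * g) $$ k = 0"
    by (simp add: fls_times_nth(2))
qed

lemma neg_grade_mult_neg_grade: "neg_grade (neg_grade f * neg_grade g) = neg_grade f * neg_grade g"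
proof (rule fls_eqI)
  fix k
  have "neg_grade f $$ i * neg_grade g $$ (k - i) = 0" if "k \<le> 0" for i
    using that by (auto simp: neg_grade_nth)
  then show "neg_grade (neg_grade f * neg_grade g) $$ k = (neg_grade f * neg_grade g) $$ k"
    by (simp add: neg_grade_nth[of "_ * _"] fls_times_nth(2))
qed

section \<open>The projection on matrices: both grade halves are closed under products\<close>

definition neg_matrix :: "'f::comm_ring_1 fls^'n^'n \<Rightarrow> 'f fls^'n^'n" where
  "neg_matrix = map_matrix neg_grade"

lemma neg_matrix_nth [simp]: "neg_matrix X $ i $ j = neg_grade (X $ i $ j)"
  by (simp add: neg_matrix_def)

lemma neg_matrix_add: "neg_matrix (X + Y) = neg_matrix X + neg_matrix Y"
  by (simp add: vec_eq_iff neg_grade_add)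

lemma neg_matrix_diff: "neg_matrix (X - Y) = neg_matrix X - neg_matrix Y"
  by (simp add: vec_eq_iff neg_grade_diff)

lemma neg_matrix_idem: "neg_matrix (neg_matrix X) = neg_matrix X"
  by (simp add: vec_eq_iff)

lemma neg_matrix_mscale: "neg_matrix (mscale (of_int c) X) = mscale (of_int c) (neg_matrix X)"
  by (simp add: vec_eq_iff neg_grade_of_int_mult)

lemma neg_matrix_coeffwise:
  "derivation D \<Longrightarrow>
    neg_matrix (map_matrix (coeffwise D) X) = map_matrix (coeffwise D) (neg_matrix X)"
  by (simp add: vec_eq_iff neg_grade_coeffwise)

lemma neg_matrix_l_der_eq_0: "neg_matrix X = 0 \<Longrightarrow> neg_matrix (map_matrix (l_der m) X) = 0"
  by (simp add: vec_eq_iff neg_grade_l_der_eq_0)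

lemma neg_matrix_mult_eq_0:
  "neg_matrix X = 0 \<Longrightarrow> neg_matrix Y = 0 \<Longrightarrow> neg_matrix (X ** Y) = 0"
  by (simp add: vec_eq_iff matrix_matrix_mult_def neg_grade_sum neg_grade_mult_eq_0)

lemma neg_matrix_mult_neg_matrix:
  "neg_matrix (neg_matrix X ** neg_matrix Y) = neg_matrix X ** neg_matrix Y"
  by (simp add: vec_eq_iff matrix_matrix_mult_def neg_grade_sum neg_grade_mult_neg_grade)


subsection \<open>Invertibility of the dressing operator\<close>

lemma lax_op_mult:
  assumes "derivation Dx"
  shows "lax_op Dx B (f *s \<psi>) = coeffwise Dx f *s \<psi> + f *s lax_op Dx B \<psi>"
  by (simp add: vec_eq_iff lax_op_def coeffwise_mult[OF assms] matrix_vector_mult_def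
      sum_distrib_left algebra_simps)

lemma matrix_vector_mult_smult:
  "A *v (c *s v) = c *s (A *v (v :: 'a::comm_ring_1^'n))"
  by (simp add: vec_eq_iff matrix_vector_mult_def sum_distrib_left mult_ac)

text \<open>Evaluating the dressing relation at \<open>\<psi>\<close> and at \<open>x \<psi>\<close>, where \<open>\<partial>\<^sub>x x = 1\<close>, isolates the
  symbol of \<open>\<Theta>\<^sup>-\<^sup>1 D\<^sub>x \<Theta>\<close>, which is \<open>\<Theta>\<^sup>-\<^sup>1 \<Theta>\<close>.\<close>

lemma dressing_left_inverse:
  fixes T \<Theta> :: "'f::comm_ring_1 fls^'n^'n"
  assumes D: "derivation Dx" "Dx x = 1"
    and dr: "\<And>\<psi>. T *v lax_op Dx B (\<Theta> *v \<psi>) = lax_op Dx C \<psi>"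
  shows "T ** \<Theta> = mat 1"
proof -
  have x: "coeffwise Dx (fls_const x) = 1"
    by (simp add: coeffwise_fls_const D)
  have "T *v (\<Theta> *v \<psi>) = \<psi>" for \<psi>
    \<comment> \<open>The Leibniz terms leave \<open>T *v (\<Theta> *v \<psi>)\<close> on one side
      and \<open>\<psi>\<close> on the other; the remaining terms agree by the relation at
      \<open>\<psi>\<close>.\<close>
    using dr[of "fls_const x *s \<psi>"]
    by (simp add: matrix_vector_mult_smult lax_op_mult[OF D(1)] matrix_vector_right_distrib x dr)
  then show ?thesis
    by (simp add: matrix_eq matrix_vector_mul_assoc)
qed

text \<open>As \<Theta> is 1 plus negative grades, the leading coefficient of
  \<open>X ** \<Theta>\<close> is that of \<open>X\<close>; hence the coefficients of
  \<open>X\<close> vanish one after another.\<close>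

lemma dressing_series_right_cancel:
  fixes X \<Theta> :: "'f::comm_ring_1 fls^'n^'n"
  assumes \<Theta>: "dressing_series \<Theta>" and X: "X ** \<Theta> = 0"
  shows "X = 0"
proof -
  have \<Theta>0: "\<Theta> $ i $ j $$ 0 = (if i = j then 1 else 0)" for i j
    using \<Theta> by (simp add: dressing_series_def grade_part_def vec_eq_iff mat_def)
  have \<Theta>neg: "\<Theta> $ i $ j $$ k = 0" if "k < 0" for i j k
  proof -
    have "grade_part (- k) \<Theta> = 0"
      using \<Theta> that by (simp add: dressing_series_def)
    then show ?thesis
      by (simp add: grade_part_def vec_eq_iff)
  qed
  \<comment> \<open>A common lower bound for the exponents of all entries, where the induction
    starts.\<close>
  define K where "K = Min (range (\<lambda>(i, j). fls_subdegree (X $ i $ j)))"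
  have K: "X $ i $ j $$ k = 0" if "k < K" for i j k
  proof -
    have "K \<le> fls_subdegree (X $ i $ j)"
      unfolding K_def by (rule Min_le) auto
    then show ?thesis using that by simp
  qed
  have "\<forall>i j. \<forall>k < K + int p. X $ i $ j $$ k = 0" for p
  proof (induction p)
    case 0
    then show ?case using K by simp
  next
    case (Suc p)
    let ?k = "K + int p"
    have "X $ i $ j $$ ?k = 0" for i j
    proof -
      \<comment> \<open>By the induction hypothesis the convolution shrinks to the single index
        \<open>?k\<close>, paired with the identity coefficient of \<Theta>.\<close>
      have *: "(X $ i $ l * \<Theta> $ l $ j) $$ ?k = (if l = j then X $ i $ l $$ ?k else 0)" for l
        by (subst fls_times_nth_bounds[where N = ?k and M = 0])
          (use Suc \<Theta>neg in \<open>auto simp: \<Theta>0\<close>)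
      have "0 = (X ** \<Theta>) $ i $ j $$ ?k"
        by (simp add: X)
      also have "\<dots> = (\<Sum>l\<in>UNIV. (X $ i $ l * \<Theta> $ l $ j) $$ ?k)"
        by (simp add: matrix_matrix_mult_def fls_nth_sum)
      also have "\<dots> = X $ i $ j $$ ?k"
        by (simp add: *)
      finally show ?thesis by simp
    qed
    with Suc show ?case
      by (metis of_nat_Suc zless_add1_eq add.assoc add.commute)
  qed
  moreover have "k < K + int (nat (k - K + 1))" for k
    by linarith
  ultimately have "X $ i $ j $$ k = 0" for i j k
    by blast
  then show ?thesis
    by (simp add: vec_eq_iff fls_eq_iff)
qed

lemma dressing_right_inverse:
  assumes "dressing_series \<Theta>" "T ** \<Theta> = mat 1"
  shows "\<Theta> ** T = mat 1"
proof -
  have "(\<Theta> ** T - mat 1) ** \<Theta> = 0"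
    by (simp add: matrix_ring_simps assms)
  then show ?thesis
    using dressing_series_right_cancel[OF assms(1)] by fastforce
qed


subsection \<open>The time-dependent part of the Virasoro operators\<close>

text \<open>All time sums are multiples of one constant matrix by scalar series that differ only in
  the factor \<open>lam ^ m\<close>. Their commutativity and their behaviour under
  \<open>l_der\<close> follow from this.\<close>

lemma time_sum_factor:
  "time_sum \<iota> E0 t m =
    mscale (lam ^ m * (\<Sum>i | i \<ge> 1 \<and> t i \<noteq> 0. of_nat i * fls_const (t i) * lam ^ i))
      (map_matrix (\<lambda>c. fls_const (\<iota> c)) E0)"
  by (simp add: vec_eq_iff time_sum_def Egr_def sum_distrib_left sum_distrib_right
      power_add mult_ac del: fls_const_mult_const)

lemma time_sum_commute:
  "time_sum \<iota> E0 t m ** time_sum \<iota> E0 t n = time_sum \<iota> E0 t n ** time_sum \<iota> E0 t m"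
  by (simp add: time_sum_factor mscale_matrix_mult_left mscale_matrix_mult_right)
    (simp add: vec_eq_iff mult_ac)

lemma l_der_fls_const: "l_der m (fls_const c) = 0"
  by (intro fls_eqI) (simp add: l_der_nth del: of_int_add)

lemma l_der_time_sum:
  fixes \<iota> :: "'k::field \<Rightarrow> 'f::comm_ring_1" and E0 :: "'k^'n^'n" and t :: "nat \<Rightarrow> 'f"
  shows "map_matrix (l_der m) (time_sum \<iota> E0 t n) - map_matrix (l_der n) (time_sum \<iota> E0 t m) =
    mscale (of_int (int m - int n)) (time_sum \<iota> E0 t (m + n))"
proof -
  note der = derivation_mult[OF derivation_l_der]
  \<comment> \<open>By \<open>l_der_shift\<close> both derivatives of \<open>f\<close> contribute
    the same \<open>lam ^ (m + n) * l_der 0 f\<close>, so only the derivatives of the powers of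
    \<open>lam\<close> survive.\<close>
  have "l_der m (lam ^ n * f * fls_const c) - l_der n (lam ^ m * f * fls_const c) =
      of_int (int m - int n) * (lam ^ (m + n) * f * fls_const c)" for f and c :: 'f
    by (simp add: der l_der_lam_power l_der_fls_const l_der_shift[of m f] l_der_shift[of n f])
      (simp add: algebra_simps power_add)
  then show ?thesis
    by (simp add: vec_eq_iff time_sum_factor)
qed

lemma coeffwise_time_sum:
  assumes D: "derivation D" and \<iota>: "\<And>c. D (\<iota> c) = 0" and t: "\<And>i. i \<ge> 1 \<Longrightarrow> D (t i) = 0"
  shows "map_matrix (coeffwise D) (time_sum \<iota> E0 t m) = 0"
proof -
  note D' = derivation_coeffwise[OF D]
  note simps = derivation_mult[OF D'] derivation_sum[OF D'] derivation_of_nat[OF D']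
    derivation_power_eq_0[OF D' coeffwise_lam[OF D]] coeffwise_fls_const[OF D]
  show ?thesis
    by (simp add: vec_eq_iff time_sum_factor simps \<iota> t)
qed


subsection \<open>Zero curvature and the flows\<close>

text \<open>The matrix series left of the dressed operator after removing \<open>l_op m\<close>, as
  computed in \<open>conj_L_op\<close>.\<close>

definition virasoro_matrix ::
    "('k::field \<Rightarrow> 'f::comm_ring_1) \<Rightarrow> 'k^'n^'n \<Rightarrow> (nat \<Rightarrow> 'f) \<Rightarrow> 'f fls^'n^'n \<Rightarrow> nat
      \<Rightarrow> 'f fls^'n^'n" where
  "virasoro_matrix \<iota> E0 t \<Theta> m =
     \<Theta> ** map_matrix (l_der m) (matrix_inv \<Theta>) - \<Theta> ** time_sum \<iota> E0 t m ** matrix_inv \<Theta>"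

lemma matrix_of_mult_vector: "matrix (\<lambda>x. A *v x) = (A :: 'a::comm_ring_1^'n^'m)"
  by (simp add: vec_eq_iff matrix_def matrix_vector_mult_def axis_def if_distrib cong: if_cong)

lemma vir_flow_eq:
  assumes "\<Theta> ** matrix_inv \<Theta> = mat 1"
  shows "vir_flow \<iota> E0 t \<Theta> m = neg_matrix (virasoro_matrix \<iota> E0 t \<Theta> m) ** \<Theta>"
proof -
  have "conj_op \<Theta> (L_op \<iota> E0 t m) \<psi> - l_op m \<psi> = virasoro_matrix \<iota> E0 t \<Theta> m *v \<psi>" for \<psi>
    by (simp add: conj_L_op[OF assms] virasoro_matrix_def l_der_def[abs_def])
  then show ?thesis
    by (simp add: vir_flow_def minus_part_def neg_matrix_def matrix_of_mult_vector)
qed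

text \<open>The matrix form of \<open>[L\<^sub>m\<^sup>\<Theta>, L\<^sub>n\<^sup>\<Theta>] = (m - n) L\<^sub>m\<^sub>+\<^sub>n\<^sup>\<Theta>\<close>.\<close>

lemma virasoro_matrix_zero_curvature:
  fixes \<iota> :: "'k::field \<Rightarrow> 'f::comm_ring_1" and E0 :: "'k^'n^'n" and t :: "nat \<Rightarrow> 'f"
    and \<Theta> :: "'f::comm_ring_1 fls^'n^'n"
  assumes inv: "matrix_inv \<Theta> ** \<Theta> = mat 1" "\<Theta> ** matrix_inv \<Theta> = mat 1"
  defines "M \<equiv> virasoro_matrix \<iota> E0 t \<Theta>"
  shows "map_matrix (l_der m) (M n) - map_matrix (l_der n) (M m) + bracket (M m) (M n) =
    mscale (of_int (int m - int n)) (M (m + n))"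
proof -
  define T where "T = matrix_inv \<Theta>"
  define S where "S = time_sum \<iota> E0 t"
  define d where "d k = (map_matrix (l_der k) :: 'f fls^'n^'n \<Rightarrow> _)" for k
  note inv = inv[folded T_def]
  note der = derivation_l_der
  have M: "M k = \<Theta> ** d k T - \<Theta> ** S k ** T" for k
    by (simp add: M_def virasoro_matrix_def T_def S_def d_def)
  have d: "d k (X ** Y) = d k X ** Y + X ** d k Y" "d k (X - Y) = d k X - d k Y" for k X Y
    by (simp_all add: d_def map_matrix_derivation_mult[OF der] map_matrix_derivation_diff[OF der])
  have d\<Theta>: "d k \<Theta> = - (\<Theta> ** d k T ** \<Theta>)" for k
    unfolding d_def by (rule map_matrix_derivation_inverse[OF der inv(2,1)])
  have cancel: "T ** (\<Theta> ** X) = X" for X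
    by (simp add: matrix_mul_assoc inv)
  have SS: "\<Theta> ** (S m ** (S n ** T)) = \<Theta> ** (S n ** (S m ** T))"
    using time_sum_commute[of \<iota> E0 t m n] by (simp add: S_def matrix_mul_assoc)
  \<comment> \<open>After inserting \<open>d\<Theta>\<close>, all terms with first derivatives of
    \<open>T\<close> cancel against the bracket; the products of two \<open>S\<close> cancel by
    \<open>SS\<close>.\<close>
  have "d m (M n) - d n (M m) + bracket (M m) (M n) =
      \<Theta> ** (d m (d n T) - d n (d m T)) - \<Theta> ** (d m (S n) - d n (S m)) ** T"
    by (simp add: M bracket_def d d\<Theta> matrix_ring_simps cancel SS)
  also have "d m (d n T) - d n (d m T) = mscale (of_int (int m - int n)) (d (m + n) T)"
    by (simp add: vec_eq_iff d_def l_der_commutator del: of_int_diff)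
  also have "d m (S n) - d n (S m) = mscale (of_int (int m - int n)) (S (m + n))"
    unfolding d_def S_def by (rule l_der_time_sum)
  finally show ?thesis
    by (simp add: M d_def mscale_diff mscale_matrix_mult_left mscale_matrix_mult_right)
qed

text \<open>The matrix form of \<open>\<delta> L\<^sub>n\<^sup>\<Theta> = [N, L\<^sub>n\<^sup>\<Theta>]\<close> for \<open>\<delta> \<Theta> = N \<Theta>\<close>.\<close>

lemma virasoro_matrix_flow:
  fixes \<iota> :: "'k::field \<Rightarrow> 'f::comm_ring_1" and E0 :: "'k^'n^'n" and t :: "nat \<Rightarrow> 'f"
    and \<Theta> N :: "'f::comm_ring_1 fls^'n^'n"
  assumes inv: "matrix_inv \<Theta> ** \<Theta> = mat 1" "\<Theta> ** matrix_inv \<Theta> = mat 1"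
    and D: "derivation D" and \<iota>: "\<And>c. D (\<iota> c) = 0" and t: "\<And>i. i \<ge> 1 \<Longrightarrow> D (t i) = 0"
    and flow: "map_matrix (coeffwise D) \<Theta> = N ** \<Theta>"
  defines "M \<equiv> virasoro_matrix \<iota> E0 t \<Theta>"
  shows "map_matrix (coeffwise D) (M n) = bracket N (M n) - map_matrix (l_der n) N"
proof -
  define T where "T = matrix_inv \<Theta>"
  define S where "S = time_sum \<iota> E0 t n"
  define d where "d = (map_matrix (l_der n) :: 'f fls^'n^'n \<Rightarrow> _)"
  define \<delta> where "\<delta> = (map_matrix (coeffwise D) :: 'f fls^'n^'n \<Rightarrow> _)"
  note inv = inv[folded T_def]
  note der = derivation_l_der
  note D' = derivation_coeffwise[OF D]
  have M: "M n = \<Theta> ** d T - \<Theta> ** S ** T"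
    by (simp add: M_def virasoro_matrix_def T_def S_def d_def)
  have d: "d (X ** Y) = d X ** Y + X ** d Y" "d (- X) = - d X" for X Y
    by (simp_all add: d_def map_matrix_derivation_mult[OF der] map_matrix_derivation_minus[OF der])
  have \<delta>: "\<delta> (X ** Y) = \<delta> X ** Y + X ** \<delta> Y" "\<delta> (X - Y) = \<delta> X - \<delta> Y" for X Y
    by (simp_all add: \<delta>_def map_matrix_derivation_mult[OF D'] map_matrix_derivation_diff[OF D'])
  have \<delta>\<Theta>: "\<delta> \<Theta> = N ** \<Theta>"
    by (simp add: \<delta>_def flow)
  have cancel: "\<Theta> ** (T ** X) = X" for X
    by (simp add: matrix_mul_assoc inv)
  have \<delta>T: "\<delta> T = - (T ** N)"
    using map_matrix_derivation_inverse[OF D' inv]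
    by (simp add: \<delta>\<Theta>[unfolded \<delta>_def] \<delta>_def matrix_ring_simps inv)
  have \<delta>S: "\<delta> S = 0"
    unfolding \<delta>_def S_def by (rule coeffwise_time_sum[OF D \<iota> t])
  have \<delta>d: "\<delta> (d X) = d (\<delta> X)" for X
    by (simp add: \<delta>_def d_def vec_eq_iff coeffwise_l_der[OF D])
  \<comment> \<open>Since \<open>\<delta> T = - (T ** N)\<close>, the term
    \<open>\<Theta> ** d (\<delta> T)\<close> yields \<open>- d N\<close> and, with the time part,
    \<open>- (M n ** N)\<close>.\<close>
  have "\<delta> (M n) = bracket N (M n) - d N"
    by (simp add: M bracket_def \<delta> \<delta>\<Theta> \<delta>d \<delta>T \<delta>S d matrix_ring_simps cancel)
  then show ?thesis
    by (simp add: \<delta>_def d_def)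
qed

text \<open>Pure grading algebra, for arbitrary \<open>M\<close> and \<open>M'\<close>: the two
  sides differ by the projection of terms built from \<open>P\<close> and \<open>P'\<close>
  alone.\<close>

lemma neg_matrix_projected_curvature:
  fixes M M' :: "'f::comm_ring_1 fls^'n^'n"
  defines "N \<equiv> neg_matrix M" and "N' \<equiv> neg_matrix M'"
  shows "neg_matrix (bracket N M' - map_matrix (l_der n) N)
      - neg_matrix (bracket N' M - map_matrix (l_der m) N') - bracket N N' =
    neg_matrix (map_matrix (l_der m) M' - map_matrix (l_der n) M + bracket M M')"
proof -
  define P P' where "P = M - N" and "P' = M' - N'"
  have [simp]: "neg_matrix P = 0" "neg_matrix P' = 0"
    by (simp_all add: P_def P'_def N_def N'_def neg_matrix_diff neg_matrix_idem)
  have MM: "M = N + P" "M' = N' + P'"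
    by (simp_all add: P_def P'_def)
  \<comment> \<open>This lets the unprojected \<open>bracket N N'\<close> be moved under the
    projection.\<close>
  have NN: "neg_matrix (N ** N') = N ** N'" "neg_matrix (N' ** N) = N' ** N"
    by (simp_all add: N_def N'_def neg_matrix_mult_neg_matrix)
  show ?thesis
    unfolding MM
    by (simp add: bracket_def matrix_ring_simps neg_matrix_add neg_matrix_diff NN
        map_matrix_derivation_add[OF derivation_l_der] neg_matrix_l_der_eq_0 neg_matrix_mult_eq_0)
qed

theorem mainTheorem10:
  fixes \<iota> :: "'k::{alg_closed_field, field_char_0} \<Rightarrow> 'f::comm_ring_1"
    and \<gg> :: "('k^'n^'n) set"
    and E0 :: "'k^'n^'n"
    and t :: "nat \<Rightarrow> 'f"
    and Dx :: "'f \<Rightarrow> 'f"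
    and A \<Theta> :: "'f fls^'n^'n"
    and \<delta> :: "nat \<Rightarrow> 'f \<Rightarrow> 'f"
    and m n :: nat
  assumes "const_hom \<iota>"
    and "matrix_lie_algebra \<gg>"
    and "semisimple_element \<gg> E0"
    and "finite {i. i \<ge> 1 \<and> t i \<noteq> 0}"
    and "derivation Dx" and "\<And>c. Dx (\<iota> c) = 0"
    and "Dx (t 1) = 1" and "\<And>i. i \<ge> 2 \<Longrightarrow> Dx (t i) = 0"
    and "A \<in> im_ad_zero \<iota> \<gg> E0"
    and "dressing_series \<Theta>"
    and "\<And>\<psi>. matrix_inv \<Theta> *v lax_op Dx (Egr \<iota> E0 1 + A) (\<Theta> *v \<psi>) = lax_op Dx (Egr \<iota> E0 1) \<psi>"
    and "\<And>k. derivation (\<delta> k)" and "\<And>k c. \<delta> k (\<iota> c) = 0" and "\<And>k i. i \<ge> 1 \<Longrightarrow> \<delta> k (t i) = 0"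
    and "\<And>k. map_matrix (coeffwise (\<delta> k)) \<Theta> = vir_flow \<iota> E0 t \<Theta> k"
  shows "map_matrix (coeffwise (\<delta> m)) (map_matrix (coeffwise (\<delta> n)) \<Theta>)
           - map_matrix (coeffwise (\<delta> n)) (map_matrix (coeffwise (\<delta> m)) \<Theta>)
         = mscale (of_int (int m - int n)) (map_matrix (coeffwise (\<delta> (m + n))) \<Theta>)"
proof -
  define M where "M = virasoro_matrix \<iota> E0 t \<Theta>"
  define N where "N k = neg_matrix (M k)" for k
  \<comment> \<open>\<open>matrix_inv\<close> is a choice, so its inverse property has to be earned:
    the dressing relation gives the left inverse, the grading of \<Theta> the right one.\<close>
  have inv: "matrix_inv \<Theta> ** \<Theta> = mat 1" "\<Theta> ** matrix_inv \<Theta> = mat 1"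
    using dressing_left_inverse[OF assms(5,7,11)] dressing_right_inverse[OF assms(10)] by auto
  let ?d = "\<lambda>k. map_matrix (coeffwise (\<delta> k)) :: 'f fls^'n^'n \<Rightarrow> _"
  have flow: "?d k \<Theta> = N k ** \<Theta>" for k
    by (simp add: assms(15) vir_flow_eq[OF inv(2)] N_def M_def)
  \<comment> \<open>The projection commutes with coefficientwise flows, so it may be applied to the
    flow of \<open>M l\<close>.\<close>
  have \<delta>N: "?d k (N l) = neg_matrix (bracket (N k) (M l) - map_matrix (l_der l) (N k))" for k l
    using virasoro_matrix_flow[where \<iota> = \<iota> and t = t and n = l, OF inv assms(12,13,14) flow]
    by (simp add: N_def M_def flip: neg_matrix_coeffwise[OF assms(12)])
  have \<delta>mult: "?d k (X ** Y) = ?d k X ** Y + X ** ?d k Y" for k X Y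
    by (rule map_matrix_derivation_mult[OF derivation_coeffwise[OF assms(12)]])
  \<comment> \<open>The Leibniz rule puts the later flow on the right,
    \<open>N n ** N m ** \<Theta>\<close>, hence the minus sign of the bracket.\<close>
  have "?d m (?d n \<Theta>) - ?d n (?d m \<Theta>) = (?d m (N n) - ?d n (N m) - bracket (N m) (N n)) ** \<Theta>"
    by (simp add: flow \<delta>mult bracket_def matrix_ring_simps)
  also have "?d m (N n) - ?d n (N m) - bracket (N m) (N n) =
      mscale (of_int (int m - int n)) (N (m + n))"
    using neg_matrix_projected_curvature[of "M m" "M n" n m]
      virasoro_matrix_zero_curvature[OF inv, of m \<iota> E0 t n, folded M_def]
    by (simp add: \<delta>N neg_matrix_mscale del: of_int_diff flip: N_def)
  finally show ?thesis
    by (simp add: flow mscale_matrix_mult_left)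
qed

end
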